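(* There is a countable adequate partial semigroup $(S,* )$ such that $S$ is not a $1$-CR set in $S$. In particular, since $S$ is a piecewise syndetic subset of itself, a piecewise syndetic set in an adequate partial semigroup need not be a $1$-CR set (and hence need not be a CR set).
   Context: A partial semigroup is a pair $(S,* )$ where $S$ is a nonempty set and $*$ is an operation defined on a nonempty subset of $S\times S$ such that for all $x,y,z\in S$, $(x*y)*z=x*(y*z)$ in the sense that if either side is defined then so is the other and they are equal. For $a\in S$, $\varphi(a)=\{b\in S: a*b \text{ is defined}\}$; for finite nonempty $F\subseteq S$, $\sigma(F)=\bigcap_{a\in F}\varphi(a)$. $(S,* )$ is adequate if $\sigma(F)\neq\emptyset$ for all finite nonempty $F$. $\mathcal{P}_f(X)$ denotes the set of finite nonempty subsets of $X$. Products $\prod_{t\in H}f(t)$ are computed in increasing order of indices. A sequence $f:\mathbb{N}\to S$ is adequate if (i) for each $H\in\mathcal{P}_f(\mathbb{N})$, $\prod_{t\in H}f(t)$ is defined, and (ii) for each $F\in\mathcal{P}_f(S)$ there is $m\in\mathbb{N}$ such that $\prod_{t\in H}f(t)\in\sigma(F)$ for all $H\in\mathcal{P}_f(\mathbb{N})$ with $\min H\geq m$. $\mathcal{T}$ denotes the set of adequate sequences, and $\mathcal{P}_f(\mathcal{T})_{\leq k}=\{F\in\mathcal{P}_f(\mathcal{T}): |F|\leq k\}$. For $k\in\mathbb{N}$, $A\subseteq S$ is a $k$-CR set if for every $L\in\mathcal{P}_f(S)$ there is $r\in\mathbb{N}$ such that for every $F\in\mathcal{P}_f(\mathcal{T})_{\leq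 k}$ there exist $m\in\mathbb{N}$, $a\in S^{m+1}$ and $t(1)<\dots<t(m)\leq r$ in $\mathbb{N}$ such that for all $f\in F$, $a(1)*f(t(1))*a(2)*\dots*a(m)*f(t(m))*a(m+1)$ is defined and lies in $A\cap\sigma(L)$. $A$ is a CR set if it is a $k$-CR set for every $k$. With $\beta S$ the set of ultrafilters on $S$, $\overline{A}=\{p\in\beta S:A\in p\}$, $\delta S=\bigcap_{F\in\mathcal{P}_f(S)}\overline{\sigma(F)}$, $x^{-1}A=\{y\in\varphi(x):x*y\in A\}$, and $p*q=\{A: \{x: x^{-1}A\in q\}\in p\}$ for $p,q\in\delta S$, $\delta S$ is a compact right topological semigroup with smallest ideal $K(\delta S)$; $A$ is piecewise syndetic if $\overline{A}\cap K(\delta S)\neq\emptyset$. *)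

theory Defs
  imports Main "HOL-Library.FuncSet" "HOL-Library.Countable_Set"
begin

definition Pf :: "'a set \<Rightarrow> 'a set set" where
  "Pf X = {F. F \<subseteq> X \<and> finite F \<and> F \<noteq> {}}"

text \<open>The partial operation has values in an option type: \<open>mul x y = None\<close> means that
  \<open>x * y\<close> is undefined. Associativity is then an equation between options, which says that one
  side is defined iff the other is, and that the values agree.\<close>

locale partial_semigroup =
  fixes S :: "'a set" and mul :: "'a \<Rightarrow> 'a \<Rightarrow> 'a option"
  assumes carrier_nonempty: "S \<noteq> {}"
    and mul_closed: "mul x y = Some z \<Longrightarrow> x \<in> S \<and> y \<in> S \<and> z \<in> S"
    and domain_nonempty: "\<exists>x y. mul x y \<noteq> None"
    and mul_assoc: "\<lbrakk>x \<in> S; y \<in> S; z \<in> S\<rbrakk> \<Longrightarrow>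
      Option.bind (mul x y) (\<lambda>u. mul u z) = Option.bind (mul y z) (\<lambda>v. mul x v)"
begin

definition phi :: "'a \<Rightarrow> 'a set" where
  "phi a = {b \<in> S. mul a b \<noteq> None}"

definition sigma :: "'a set \<Rightarrow> 'a set" where
  "sigma F = (\<Inter>a\<in>F. phi a)"

text \<open>Product of a list. The bracketing is irrelevant by associativity (see \<open>pprod_append\<close>
  below); the empty product does not exist.\<close>

fun pprod :: "'a list \<Rightarrow> 'a option" where
  "pprod [] = None"
| "pprod [x] = Some x"
| "pprod (x # y # ys) = Option.bind (pprod (y # ys)) (\<lambda>v. mul x v)"

definition seq_prod :: "(nat \<Rightarrow> 'a) \<Rightarrow> nat set \<Rightarrow> 'a option" where
  "seq_prod f H = pprod (map f (sorted_list_of_set H))"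

text \<open>The natural numbers start at 1 here. Sequences are extensional functions on \<open>{1..}\<close>, so
  that their (irrelevant) value at 0 does not affect the cardinality of sets of sequences.\<close>

definition adequate_seqs :: "(nat \<Rightarrow> 'a) set" where
  "adequate_seqs = {f \<in> {1..} \<rightarrow>\<^sub>E S.
     (\<forall>H\<in>Pf {1..}. seq_prod f H \<noteq> None) \<and>
     (\<forall>F\<in>Pf S. \<exists>m\<ge>1. \<forall>H\<in>Pf {1..}. Min H \<ge> m \<longrightarrow>
        (\<exists>z\<in>sigma F. seq_prod f H = Some z))}"

text \<open>The product \<open>a 1 * f (t 1) * a 2 * \<dots> * a m * f (t m) * a (m + 1)\<close>.\<close>

definition interleaved_prod ::
  "nat \<Rightarrow> (nat \<Rightarrow> 'a) \<Rightarrow> (nat \<Rightarrow> nat) \<Rightarrow> (nat \<Rightarrow> 'a) \<Rightarrow> 'a option" where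
  "interleaved_prod m a t f =
     pprod (concat (map (\<lambda>i. [a i, f (t i)]) [1..<m + 1]) @ [a (m + 1)])"

definition k_CR_set :: "nat \<Rightarrow> 'a set \<Rightarrow> bool" where
  "k_CR_set k A \<longleftrightarrow> A \<subseteq> S \<and>
     (\<forall>L\<in>Pf S. \<exists>r\<ge>1. \<forall>F\<in>Pf adequate_seqs. card F \<le> k \<longrightarrow>
        (\<exists>m\<ge>1. \<exists>a\<in>{1..m + 1} \<rightarrow> S. \<exists>t\<in>{1..m} \<rightarrow> {1..r}. strict_mono_on {1..m} t \<and>
           (\<forall>f\<in>F. \<exists>z\<in>A \<inter> sigma L. interleaved_prod m a t f = Some z)))"

definition CR_set :: "'a set \<Rightarrow> bool" where
  "CR_set A \<longleftrightarrow> (\<forall>k\<ge>1. k_CR_set k A)"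

definition beta :: "'a set set set" where
  "beta = {p. p \<subseteq> Pow S \<and> S \<in> p \<and> {} \<notin> p \<and>
     (\<forall>A\<in>p. \<forall>B\<in>p. A \<inter> B \<in> p) \<and>
     (\<forall>A\<in>p. \<forall>B. A \<subseteq> B \<and> B \<subseteq> S \<longrightarrow> B \<in> p) \<and>
     (\<forall>A. A \<subseteq> S \<longrightarrow> A \<in> p \<or> S - A \<in> p)}"

definition basic_clopen :: "'a set \<Rightarrow> 'a set set set" where
  "basic_clopen A = {p \<in> beta. A \<in> p}"

definition delta :: "'a set set set" where
  "delta = {p \<in> beta. \<forall>F\<in>Pf S. p \<in> basic_clopen (sigma F)}"

definition left_quotient :: "'a \<Rightarrow> 'a set \<Rightarrow> 'a set" where
  "left_quotient x A = {y \<in> phi x. \<exists>z\<in>A. mul x y = Some z}"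

definition ultra_mul :: "'a set set \<Rightarrow> 'a set set \<Rightarrow> 'a set set" where
  "ultra_mul p q = {A. A \<subseteq> S \<and> {x \<in> S. left_quotient x A \<in> q} \<in> p}"

definition delta_ideal :: "'a set set set \<Rightarrow> bool" where
  "delta_ideal I \<longleftrightarrow> I \<subseteq> delta \<and> I \<noteq> {} \<and>
     (\<forall>p\<in>delta. \<forall>q\<in>I. ultra_mul p q \<in> I \<and> ultra_mul q p \<in> I)"

definition K_delta :: "'a set set set" where
  "K_delta = (LEAST I. delta_ideal I)"

definition piecewise_syndetic :: "'a set \<Rightarrow> bool" where
  "piecewise_syndetic A \<longleftrightarrow> A \<subseteq> S \<and> basic_clopen A \<inter> K_delta \<noteq> {}"

lemma pprod_in_carrier: "pprod xs = Some z \<Longrightarrow> set xs \<subseteq> S \<Longrightarrow> z \<in> S"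
  by (induction xs arbitrary: z rule: pprod.induct)
    (auto split: Option.bind_splits dest: mul_closed)

lemma pprod_append:
  assumes "xs \<noteq> []" "ys \<noteq> []" "set xs \<subseteq> S" "set ys \<subseteq> S"
  shows "pprod (xs @ ys) = Option.bind (pprod xs) (\<lambda>u. Option.bind (pprod ys) (\<lambda>v. mul u v))"
  using assms
proof (induction xs rule: pprod.induct)
  case (2 x)
  then show ?case by (cases ys) auto
next
  case (3 x y xs)
  show ?case
  proof (cases "pprod (y # xs)")
    case None
    then show ?thesis using 3 by simp
  next
    case u: (Some u)
    then have uS: "u \<in> S" using 3 pprod_in_carrier by simp
    show ?thesis
    proof (cases "pprod ys")
      case None
      then show ?thesis using 3 u by (cases "mul x u") simp_all
    next
      case v: (Some v)
      then have "v \<in> S" using 3 pprod_in_carrier by simp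
      then show ?thesis using 3 u v uS mul_assoc[of x u v] by simp
    qed
  qed
qed simp

end

locale adequate_partial_semigroup = partial_semigroup +
  assumes adequate: "F \<in> Pf S \<Longrightarrow> sigma F \<noteq> {}"

end

theory Submission imports Defs begin

text \<open>Three elements suffice: \<open>S = {e, x, z}\<close> with \<open>e * e = e\<close>, \<open>x * x = x\<close> and
  \<open>x * e = x * z = z * e = z\<close>, all other products being undefined; \<open>e\<close>, \<open>x\<close>, \<open>z\<close> are coded as
  0, 1, 2. The sequences \<open>x, \<dots>, x, e, e, \<dots>\<close> are adequate because every element may be
  multiplied by \<open>e\<close> on the right, but no product that involves \<open>x\<close> equals \<open>e\<close>, the only element of
  \<open>\<sigma>({e})\<close>. Since a sequence may start with arbitrarily many copies of \<open>x\<close>, no bound \<open>r\<close>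
  works for \<open>L = {e}\<close>. On the other hand \<open>\<delta>S\<close> consists of the principal ultrafilter at \<open>e\<close> alone,
  so it is its own smallest ideal.\<close>

definition S3 :: "nat set" where
  "S3 = {0, 1, 2}"

definition mul3 :: "nat \<Rightarrow> nat \<Rightarrow> nat option" where
  "mul3 a b =
     (if a = 0 \<and> b = 0 then Some 0
      else if a = 1 \<and> b = 1 then Some 1
      else if (a, b) \<in> {(1, 0), (1, 2), (2, 0)} then Some 2
      else None)"

lemma zero_in_S3: "0 \<in> S3"
  by (simp add: S3_def)

lemma mul3_zero_left: "mul3 0 b = (if b = 0 then Some 0 else None)"
  by (simp add: mul3_def)

lemma mul3_zero_right: "a \<in> S3 \<Longrightarrow> mul3 a 0 \<noteq> None"
  by (auto simp: S3_def mul3_def)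

interpretation T: adequate_partial_semigroup S3 mul3
proof -
  interpret partial_semigroup S3 mul3
  proof
    show "x \<in> S3 \<and> y \<in> S3 \<and> z \<in> S3" if "mul3 x y = Some z" for x y z
      using that by (auto simp: S3_def mul3_def split: if_splits)
    \<comment> \<open>A check of the 27 triples over the three elements, obtained by splitting the
      three memberships in \<open>S3\<close>.\<close>
    show "Option.bind (mul3 x y) (\<lambda>u. mul3 u z) = Option.bind (mul3 y z) (\<lambda>v. mul3 x v)"
      if "x \<in> S3" "y \<in> S3" "z \<in> S3" for x y z
      using that unfolding S3_def by (elim insertE emptyE) (simp_all add: mul3_def)
  qed (auto simp: S3_def mul3_def)
  show "adequate_partial_semigroup S3 mul3"
  proof
    fix F assume "F \<in> Pf S3"
    then have "0 \<in> sigma F"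
      using mul3_zero_right zero_in_S3 by (fastforce simp: Pf_def sigma_def phi_def)
    then show "sigma F \<noteq> {}" by blast
  qed
qed

lemma sigma_zero: "T.sigma {0} = {0}"
  by (auto simp: T.sigma_def T.phi_def zero_in_S3 mul3_zero_left)

lemma zero_in_sigma: "F \<in> Pf S3 \<Longrightarrow> 0 \<in> T.sigma F"
  using mul3_zero_right zero_in_S3 by (fastforce simp: Pf_def T.sigma_def T.phi_def)

lemma mul3_eq_zero_iff: "mul3 a b = Some 0 \<longleftrightarrow> a = 0 \<and> b = 0"
  by (simp add: mul3_def)

text \<open>The element 0 factors only as 0 times 0, so a single other factor keeps a product away
  from 0 for good.\<close>

lemma pprod_eq_zero: "T.pprod xs = Some 0 \<Longrightarrow> set xs \<subseteq> {0}"
  by (induction xs rule: T.pprod.induct)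
    (auto simp: mul3_eq_zero_iff split: Option.bind_splits)

definition ones_then_zeros :: "nat \<Rightarrow> nat \<Rightarrow> nat" where
  "ones_then_zeros r = restrict (\<lambda>n. if n \<le> r then 1 else 0) {1..}"

text \<open>Sortedness puts every 1 to the left of every 0, so the undefined products
  \<open>mul3 0 1\<close> and \<open>mul3 0 2\<close> never arise. Left multiplication by 1 is
  defined on all of \<open>S3\<close> and gives 1 or 2, hence the first index alone decides which
  set contains the value.\<close>

lemma pprod_ones_then_zeros:
  assumes "sorted (n # ns)" "set (n # ns) \<subseteq> {1..}"
  shows "\<exists>v \<in> (if n \<le> r then {1, 2} else {0}).
    T.pprod (map (ones_then_zeros r) (n # ns)) = Some v"
  using assms
proof (induction ns arbitrary: n)
  case Nil
  then show ?case by (auto simp: ones_then_zeros_def)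
next
  case (Cons k ns)
  have "\<exists>v \<in> (if k \<le> r then {1, 2} else {0}).
      T.pprod (map (ones_then_zeros r) (k # ns)) = Some v"
    using Cons.prems by (intro Cons.IH) auto
  then obtain v where v: "v \<in> (if k \<le> r then {1, 2} else {0})"
      "T.pprod (map (ones_then_zeros r) (k # ns)) = Some v"
    by blast
  moreover have "n \<le> k" "1 \<le> n"
    using Cons.prems by auto
  then have "\<exists>w \<in> (if n \<le> r then {1, 2} else {0}). mul3 (ones_then_zeros r n) v = Some w"
    using v(1) by (auto simp: ones_then_zeros_def mul3_def split: if_splits)
  ultimately show ?case
    by simp
qed

lemma ones_then_zeros_adequate: "ones_then_zeros r \<in> T.adequate_seqs"
proof -
  have prod: "\<exists>v \<in> (if Min H \<le> r then {1, 2} else {0}).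
      T.seq_prod (ones_then_zeros r) H = Some v" if "H \<in> Pf {1..}" for H
  proof -
    have H: "finite H" "H \<noteq> {}" "H \<subseteq> {1..}"
      using that by (auto simp: Pf_def)
    have list: "sorted_list_of_set H = Min H # sorted_list_of_set (H - {Min H})"
      using H by (intro sorted_list_of_set_nonempty)
    have "sorted (Min H # sorted_list_of_set (H - {Min H}))"
      "set (Min H # sorted_list_of_set (H - {Min H})) \<subseteq> {1..}"
      using H by (simp_all only: list[symmetric] sorted_sorted_list_of_set set_sorted_list_of_set)
    from pprod_ones_then_zeros[OF this, of r] show ?thesis
      by (simp only: T.seq_prod_def list)
  qed
  have "\<exists>m\<ge>1. \<forall>H\<in>Pf {1..}. Min H \<ge> m \<longrightarrow>
      (\<exists>z\<in>T.sigma F. T.seq_prod (ones_then_zeros r) H = Some z)" if "F \<in> Pf S3" for F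
  \<comment> \<open>Beyond \<open>r\<close> all terms are 0, and 0 lies in every
    \<open>T.sigma F\<close>, so one threshold serves every \<open>F\<close>.\<close>
  proof (intro exI[of _ "Suc r"] conjI ballI impI)
    fix H assume "H \<in> Pf {1..}" "Suc r \<le> Min H"
    then have "T.seq_prod (ones_then_zeros r) H = Some 0"
      using prod[of H] by simp
    then show "\<exists>z\<in>T.sigma F. T.seq_prod (ones_then_zeros r) H = Some z"
      using zero_in_sigma[OF that] by blast
  qed simp
  moreover have "T.seq_prod (ones_then_zeros r) H \<noteq> None" if "H \<in> Pf {1..}" for H
    using prod[OF that] by blast
  moreover have "ones_then_zeros r \<in> {1..} \<rightarrow>\<^sub>E S3"
    by (auto simp: ones_then_zeros_def S3_def)
  ultimately show ?thesis
    unfolding T.adequate_seqs_def by blast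
qed

lemma not_1_CR: "\<not> T.k_CR_set 1 S3"
proof
  assume "T.k_CR_set 1 S3"
  moreover have "{0} \<in> Pf S3"
    by (simp add: Pf_def zero_in_S3)
  ultimately obtain r where r: "\<forall>F\<in>Pf T.adequate_seqs. card F \<le> 1 \<longrightarrow>
      (\<exists>m\<ge>1. \<exists>a\<in>{1..m + 1} \<rightarrow> S3. \<exists>t\<in>{1..m} \<rightarrow> {1..r}. strict_mono_on {1..m} t \<and>
        (\<forall>f\<in>F. \<exists>z\<in>S3 \<inter> T.sigma {0}. T.interleaved_prod m a t f = Some z))"
    unfolding T.k_CR_set_def by blast
  \<comment> \<open>The block of ones is as long as the alleged bound \<open>r\<close>, so every
    admissible index falls into it.\<close>
  have "{ones_then_zeros r} \<in> Pf T.adequate_seqs" "card {ones_then_zeros r} \<le> 1"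
    using ones_then_zeros_adequate by (auto simp: Pf_def)
  then obtain m a t where m: "m \<ge> 1" and t: "t \<in> {1..m} \<rightarrow> {1..r}"
    and "\<exists>z\<in>S3 \<inter> T.sigma {0}. T.interleaved_prod m a t (ones_then_zeros r) = Some z"
    using r by blast
  then have "T.interleaved_prod m a t (ones_then_zeros r) = Some 0"
    by (auto simp: sigma_zero)
  then have "set (concat (map (\<lambda>i. [a i, ones_then_zeros r (t i)]) [1..<m + 1]) @ [a (m + 1)])
      \<subseteq> {0}"
    unfolding T.interleaved_prod_def by (rule pprod_eq_zero)
  \<comment> \<open>As \<open>m\<close> is at least 1, the term at \<open>t 1\<close> does occur
    among the factors; but \<open>t 1\<close> \<le> \<open>r\<close> makes it 1.\<close>
  then have "ones_then_zeros r (t 1) = 0"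
    using m by (simp add: upt_conv_Cons del: upt_Suc)
  moreover have "t 1 \<in> {1..r}"
    using t m by auto
  ultimately show False
    by (simp add: ones_then_zeros_def)
qed

text \<open>Because \<open>T.sigma {0}\<close> is \<open>{0}\<close>, every member of
  \<open>T.delta\<close> contains \<open>{0}\<close> and is thus principal at 0. Conversely, 0 lies
  in every \<open>T.sigma F\<close>.\<close>

lemma delta_eq: "T.delta = {{A. A \<subseteq> S3 \<and> 0 \<in> A}}" (is "_ = {?p}")
proof
  show "T.delta \<subseteq> {?p}"
  proof
    fix p assume p: "p \<in> T.delta"
    moreover have "{0} \<in> Pf S3"
      by (simp add: Pf_def zero_in_S3)
    ultimately have "T.sigma {0} \<in> p"
      unfolding T.delta_def T.basic_clopen_def by blast
    then have zero: "{0} \<in> p"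
      by (simp add: sigma_zero)
    have beta: "p \<subseteq> Pow S3" "{} \<notin> p" "\<forall>A\<in>p. \<forall>B\<in>p. A \<inter> B \<in> p"
        "\<forall>A\<in>p. \<forall>B. A \<subseteq> B \<and> B \<subseteq> S3 \<longrightarrow> B \<in> p"
      using p by (simp_all add: T.delta_def T.beta_def)
    have "0 \<in> A" if "A \<in> p" for A
    proof (rule ccontr)
      assume "0 \<notin> A"
      then have "A \<inter> {0} = {}" by simp
      then show False
        using beta(2,3) zero that by metis
    qed
    moreover have "A \<in> p" if "A \<subseteq> S3" "0 \<in> A" for A
      using beta(4)[rule_format, OF zero, of A] that by simp
    ultimately have "A \<in> p \<longleftrightarrow> A \<subseteq> S3 \<and> 0 \<in> A" for A
      using beta(1) by auto
    then show "p \<in> {?p}"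
      by blast
  qed
  have "T.sigma F \<subseteq> S3" if "F \<in> Pf S3" for F
    using that by (auto simp: Pf_def T.sigma_def T.phi_def)
  then show "{?p} \<subseteq> T.delta"
    using zero_in_sigma zero_in_S3 by (auto simp: T.delta_def T.basic_clopen_def T.beta_def)
qed

lemma piecewise_syndetic_carrier: "T.piecewise_syndetic S3"
proof -
  let ?p = "{A. A \<subseteq> S3 \<and> 0 \<in> A}"
  have "0 \<in> T.left_quotient 0 A \<longleftrightarrow> 0 \<in> A" for A
    by (auto simp: T.left_quotient_def T.phi_def zero_in_S3 mul3_zero_left)
  moreover have "T.left_quotient a A \<subseteq> S3" for a A
    by (auto simp: T.left_quotient_def T.phi_def)
  \<comment> \<open>The principal ultrafilter inherits idempotence from 0 times 0 being 0.\<close>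
  ultimately have "T.ultra_mul ?p ?p = ?p"
    using zero_in_S3 by (auto simp: T.ultra_mul_def)
  then have "T.delta_ideal {?p}"
    by (simp add: T.delta_ideal_def delta_eq)
  \<comment> \<open>An ideal is a nonempty subset of the singleton \<open>T.delta\<close>, so there
    is only one candidate.\<close>
  then have "T.K_delta = {?p}"
    unfolding T.K_delta_def
    by (rule Least_equality) (auto simp add: T.delta_ideal_def delta_eq subset_singleton_iff)
  moreover have "?p \<in> T.delta"
    by (simp add: delta_eq)
  then have "?p \<in> T.basic_clopen S3"
    by (simp add: T.delta_def T.basic_clopen_def zero_in_S3)
  ultimately show ?thesis
    by (simp add: T.piecewise_syndetic_def)
qed

theorem theorem2p10:
  "\<exists>(S :: nat set) mul.
     countable S \<and> adequate_partial_semigroup S mul \<and>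
     \<not> partial_semigroup.k_CR_set S mul 1 S \<and>
     partial_semigroup.piecewise_syndetic S mul S \<and>
     \<not> partial_semigroup.CR_set S mul S"
proof (intro exI conjI)
  show "adequate_partial_semigroup S3 mul3"
    by (rule T.adequate_partial_semigroup_axioms)
  show "\<not> T.CR_set S3"
    using not_1_CR unfolding T.CR_set_def by blast
  show "countable S3"
    by (simp add: S3_def)
qed (rule not_1_CR piecewise_syndetic_carrier)+

end
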